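(* Let $b,c$ be positive integers with $q=\gcd(b,c)$ and let $p>1$ be an integer. Let $\chi_1$ and $\chi_2$ be non-principal primitive Dirichlet characters of modulus $k_1$ and $k_2$, respectively. If $(-1)^{p+1}\chi_1(-1)\chi_2(-1)=1$, then $$(p+1)\left(bk_2(ck_1)^{p}\,\widetilde{S}_{p}(b,c:\chi_1,\chi_2)+ck_1(bk_2)^{p}\,\widetilde{S}_{p}(c,b:\overline{\chi_2},\overline{\chi_1})\right)$$ $$=\sum_{j=0}^{p+1}\binom{p+1}{j}(bk_2)^{j}(ck_1)^{p+1-j}B_{j,\overline{\chi_1}}B_{p+1-j,\chi_2}+pq^{p+1}(k_1k_2)^{p}\sum_{h=1}^{k_1}\sum_{j=1}^{k_2}\chi_1(h)\overline{\chi_2}(j)\overline{B}_{p+1}\left(\frac{cj}{qk_2}+\frac{bh}{qk_1}\right).$$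
   Context: The Bernoulli polynomials $B_n(x)$ are defined by $\frac{te^{xt}}{e^t-1}=\sum_{n\ge0}B_n(x)\frac{t^n}{n!}$ ($|t|<2\pi$). The Bernoulli functions are $\overline{B}_n(x)=B_n(x-[x])$ for $n>1$, where $[x]$ is the largest integer $\le x$, and $\overline{B}_1(x)=x-[x]-1/2$ if $x\in\mathbb{R}\setminus\mathbb{Z}$, $\overline{B}_1(x)=0$ if $x\in\mathbb{Z}$. For a primitive Dirichlet character $\chi$ of modulus $k$, with $\overline{\chi}$ the complex conjugate character, the generalized Bernoulli polynomials $B_{n,\chi}(x)$ are defined by $\sum_{a=0}^{k-1}\frac{\overline{\chi}(a)te^{(a+x)t}}{e^{kt}-1}=\sum_{n\ge0}B_{n,\chi}(x)\frac{t^n}{n!}$ ($|t|<2\pi/k$) (note the conjugate on the left), and $B_{n,\chi}=B_{n,\chi}(0)$. For non-principal $\chi$, the generalized Bernoulli functions are $\overline{B}_{m,\chi}(x)=k^{m-1}\sum_{n=1}^{k-1}\overline{\chi}(n)\overline{B}_m\left(\frac{n+x}{k}\right)$ for $m\ge1$ and all real $x$; they have period $k$. For primitive characters $\chi_1,\chi_2$ of modulus $k_1$ and $k_2$ respectively (not necessarily equal) and positive integers $b,c$, $$\widetilde{S}_p(b,c:\chi_1,\chi_2)=\sum_{n=0}^{ck_1-1}\chi_1(n)\,\overline{B}_{p,\chi_2}\left(\frac{nbk_2}{ck_1}\right)\overline{B}_1\left(\frac{n}{ck_1}\right).$$ In $\widetilde{S}_p(c,b:\overline{\chi_2},\overline{\chi_1})$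 the roles of $k_1$ and $k_2$ are interchanged accordingly, i.e. $\widetilde{S}_p(c,b:\overline{\chi_2},\overline{\chi_1})=\sum_{n=0}^{bk_2-1}\overline{\chi_2}(n)\,\overline{B}_{p,\overline{\chi_1}}\left(\frac{nck_1}{bk_2}\right)\overline{B}_1\left(\frac{n}{bk_2}\right)$. *)

theory Defs
  imports Complex_Main "HOL-Computational_Algebra.Formal_Power_Series"
begin

section \<open>Dirichlet characters\<close>

text \<open>A character modulo \<open>k\<close> is extended to all integers by zero off the units modulo \<open>k\<close>.
  The value \<open>\<chi> 1 = 1\<close> follows from multiplicativity and \<open>\<chi> 1 \<noteq> 0\<close>.\<close>

definition dirichlet_character :: "nat \<Rightarrow> (int \<Rightarrow> complex) \<Rightarrow> bool" where
  "dirichlet_character k \<chi> \<longleftrightarrow>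
     k > 0 \<and>
     (\<forall>m n. \<chi> (m * n) = \<chi> m * \<chi> n) \<and>
     (\<forall>n. \<chi> (n + int k) = \<chi> n) \<and>
     (\<forall>n. \<chi> n \<noteq> 0 \<longleftrightarrow> coprime n (int k))"

definition principal_character :: "nat \<Rightarrow> int \<Rightarrow> complex" where
  "principal_character k = (\<lambda>n. if coprime n (int k) then 1 else 0)"

definition induced_modulus :: "nat \<Rightarrow> (int \<Rightarrow> complex) \<Rightarrow> nat \<Rightarrow> bool" where
  "induced_modulus k \<chi> d \<longleftrightarrow>
     d dvd k \<and> (\<forall>n. coprime n (int k) \<and> int d dvd n - 1 \<longrightarrow> \<chi> n = 1)"

definition primitive_character :: "nat \<Rightarrow> (int \<Rightarrow> complex) \<Rightarrow> bool" where
  "primitive_character k \<chi> \<longleftrightarrow>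
     dirichlet_character k \<chi> \<and> \<not> (\<exists>d<k. induced_modulus k \<chi> d)"

definition conj_char :: "(int \<Rightarrow> complex) \<Rightarrow> int \<Rightarrow> complex" where
  "conj_char \<chi> = (\<lambda>n. cnj (\<chi> n))"


section \<open>Bernoulli polynomials and Bernoulli functions\<close>

text \<open>The generating functions are formal power series in \<open>t = fps_X\<close>, with \<open>fps_exp c\<close>
  the expansion of \<open>exp (c * t)\<close>. Numerator and denominator both vanish at \<open>t = 0\<close>;
  the lemmas below confirm that the divisions are exact, so that the
  quotients are the Taylor series at 0 of the corresponding analytic functions.\<close>

definition bernoulli_gf :: "'a::field_char_0 \<Rightarrow> 'a fps" where
  "bernoulli_gf x = fps_X * fps_exp x / (fps_exp 1 - 1)"

definition bernpoly :: "nat \<Rightarrow> 'a::field_char_0 \<Rightarrow> 'a" where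
  "bernpoly n x = fact n * fps_nth (bernoulli_gf x) n"

text \<open>Only the indices \<open>n \<ge> 1\<close> are meaningful.\<close>

definition bernoulli_fun :: "nat \<Rightarrow> real \<Rightarrow> real" where
  "bernoulli_fun n x =
     (if n = 1 then (if x \<in> \<int> then 0 else x - of_int \<lfloor>x\<rfloor> - 1 / 2)
      else bernpoly n (x - of_int \<lfloor>x\<rfloor>))"


section \<open>Generalized Bernoulli polynomials and functions\<close>

text \<open>The character enters both generating function and Bernoulli function through its complex
  conjugate.\<close>

definition gen_bernoulli_gf :: "nat \<Rightarrow> (int \<Rightarrow> complex) \<Rightarrow> complex \<Rightarrow> complex fps" where
  "gen_bernoulli_gf k \<chi> x =
     (\<Sum>a = 0..k - 1. fps_const (cnj (\<chi> (int a))) * fps_X * fps_exp (of_nat a + x)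
                     / (fps_exp (of_nat k) - 1))"

definition gen_bernpoly :: "nat \<Rightarrow> nat \<Rightarrow> (int \<Rightarrow> complex) \<Rightarrow> complex \<Rightarrow> complex" where
  "gen_bernpoly n k \<chi> x = fact n * fps_nth (gen_bernoulli_gf k \<chi> x) n"

definition gen_bernoulli :: "nat \<Rightarrow> nat \<Rightarrow> (int \<Rightarrow> complex) \<Rightarrow> complex" where
  "gen_bernoulli n k \<chi> = gen_bernpoly n k \<chi> 0"

definition gen_bernoulli_fun :: "nat \<Rightarrow> nat \<Rightarrow> (int \<Rightarrow> complex) \<Rightarrow> real \<Rightarrow> complex" where
  "gen_bernoulli_fun m k \<chi> x =
     of_nat k ^ (m - 1) *
     (\<Sum>n = 1..k - 1. cnj (\<chi> (int n)) * of_real (bernoulli_fun m ((real n + x) / real k)))"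

lemma fps_exp_minus_one_dvd:
  fixes c :: "'a::field_char_0"
  assumes "c \<noteq> 0"
  shows "fps_exp c - 1 dvd fps_X * f"
proof -
  have "subdegree (fps_exp c - 1) = 1"
    using assms by (intro subdegreeI) auto
  moreover from this have "fps_exp c - 1 \<noteq> 0" by auto
  ultimately have "fps_exp c - 1 dvd fps_X"
    by (simp add: fps_dvd_iff)
  then show ?thesis by (rule dvd_mult2)
qed

lemma bernoulli_gf_exact:
  "bernoulli_gf x * (fps_exp 1 - 1) = fps_X * fps_exp (x :: 'a::field_char_0)"
  unfolding bernoulli_gf_def by (rule dvd_div_mult_self) (rule fps_exp_minus_one_dvd, simp)

lemma gen_bernoulli_gf_exact:
  assumes "k > 0"
  shows "gen_bernoulli_gf k \<chi> x * (fps_exp (of_nat k) - 1) =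
           (\<Sum>a = 0..k - 1. fps_const (cnj (\<chi> (int a))) * fps_X * fps_exp (of_nat a + x))"
proof -
  have "fps_exp (of_nat k) - 1 dvd fps_const c * fps_X * f" for c :: complex and f
    using fps_exp_minus_one_dvd[of "of_nat k :: complex" "fps_const c * f"] assms
    by (simp add: ac_simps)
  then show ?thesis
    unfolding gen_bernoulli_gf_def sum_distrib_right
    by (intro sum.cong refl dvd_div_mult_self)
qed


section \<open>Character Dedekind sums\<close>

text \<open>Each character carries its modulus, so exchanging the characters also exchanges the
  moduli.\<close>

definition char_dedekind_sum ::
    "nat \<Rightarrow> nat \<Rightarrow> nat \<Rightarrow> nat \<Rightarrow> (int \<Rightarrow> complex) \<Rightarrow> nat \<Rightarrow> (int \<Rightarrow> complex) \<Rightarrow> complex" where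
  "char_dedekind_sum p b c k1 \<chi>1 k2 \<chi>2 =
     (\<Sum>n = 0..c * k1 - 1.
        \<chi>1 (int n) * gen_bernoulli_fun p k2 \<chi>2 (real (n * b * k2) / real (c * k1))
                  * of_real (bernoulli_fun 1 (real n / real (c * k1))))"

end

theory Submission
  imports Defs
begin

text \<open>
  Put \<open>M = b k\<^sub>2\<close>, \<open>N = c k\<^sub>1\<close> and let \<open>\<psi>\<close> be the conjugate of \<open>\<chi>\<^sub>2\<close>. Everything is a sum over
  \<open>0 \<le> n < N\<close> and \<open>0 \<le> m < M\<close>, weighted by \<open>\<chi>\<^sub>1 n * \<psi> m\<close>, of a function of \<open>x = n/N\<close> and
  \<open>y = m/M\<close>. This rests on Raabe's multiplication formula: the sum of \<open>B\<^sub>n((x + j)/k)\<close> over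
  \<open>0 \<le> j < k\<close> is \<open>k\<^bsup>1-n\<^esup> B\<^sub>n(x)\<close>, for Bernoulli polynomials and Bernoulli functions alike. A character
  sum modulo \<open>k\<close> thereby spreads out to a character sum modulo any multiple of \<open>k\<close>.
  With \<open>\<beta>\<^sub>n\<close> denoting the Bernoulli functions, and up to the common factor \<open>(MN)\<^sup>p\<close>,

  \<^item> the two Dedekind sums have the summands \<open>\<beta>\<^sub>p(x + y) \<beta>\<^sub>1(x)\<close> and \<open>\<beta>\<^sub>p(x + y) \<beta>\<^sub>1(y)\<close>
    (\<open>char_dedekind_sum_eq\<close>);
  \<^item> the binomial sum of generalized Bernoulli numbers has the summand
    \<open>\<Sum>j. (p+1 choose j) B\<^sub>j(x) B\<^bsub>p+1-j\<^esub>(y)\<close> (\<open>gen_bernoulli_distribution\<close>);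
  \<^item> the final double sum is \<open>p\<close> times the sum with the summand \<open>\<beta>\<^bsub>p+1\<^esub>(x + y)\<close>. Here the formula is
    applied modulo \<open>b\<close> and then modulo \<open>c/q\<close>, because \<open>s \<mapsto> b s\<close> takes each value in the multiples of
    \<open>q\<close> modulo \<open>c\<close> exactly \<open>q\<close> times (\<open>character_sum_multiplication_gcd\<close>).

  The theorem is then a pointwise identity. The product of the generating functions at \<open>x\<close>
  and \<open>y\<close> is expressed by the generating function at \<open>x + y\<close> and its derivative in \<open>t\<close>, which gives
  \<open>\<Sum>j. (p+1 choose j) B\<^sub>j(x) B\<^bsub>p+1-j\<^esub>(y) = (p+1)(x+y-1) B\<^sub>p(x+y) - p B\<^bsub>p+1\<^esub>(x+y)\<close>.
  For \<open>x, y\<close> in the open unit interval \<open>x + y - 1 = \<beta>\<^sub>1(x) + \<beta>\<^sub>1(y)\<close>, and when \<open>x + y \<ge> 1\<close> the corrections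
  that turn polynomials into periodic functions cancel (\<open>bernpoly_convolution_periodic\<close>). The points
  with \<open>x = 0\<close> or \<open>y = 0\<close> do not matter: a non-principal character vanishes at \<open>0\<close>.
\<close>

section \<open>Bernoulli polynomials\<close>

text \<open>The coefficients of \<open>t e\<^bsup>at\<^esup> / (e\<^bsup>ct\<^esup> - 1)\<close>, obtained by rescaling \<open>t\<close>; the case \<open>c = k\<close> serves
  generalized Bernoulli numbers and \<open>c = 1/k\<close> the multiplication formula.\<close>

lemma coeff_bernoulli_quotient:
  fixes c :: "'a::field_char_0"
  assumes "c \<noteq> 0" and G: "G * (fps_exp c - 1) = fps_X * fps_exp a"
  shows "c * (fact n * fps_nth G n) = c ^ n * bernpoly n (a / c)"
proof -
  have "(bernoulli_gf (a / c) * (fps_exp 1 - 1)) oo (fps_const c * fps_X)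
      = (fps_X * fps_exp (a / c)) oo (fps_const c * fps_X)"
    by (simp add: bernoulli_gf_exact)
  then have "(bernoulli_gf (a / c) oo (fps_const c * fps_X)) * (fps_exp c - 1)
      = fps_const c * (fps_X * fps_exp a)"
    using assms(1)
    by (simp add: fps_compose_mult_distrib fps_compose_sub_distrib mult.assoc)
  also have "\<dots> = (fps_const c * G) * (fps_exp c - 1)"
    by (simp add: G mult.assoc)
  finally have "bernoulli_gf (a / c) oo (fps_const c * fps_X) = fps_const c * G"
    using assms(1) by simp
  then have "fps_nth (bernoulli_gf (a / c) oo (fps_const c * fps_X)) n = fps_nth (fps_const c * G) n"
    by simp
  then have "c * fps_nth G n = c ^ n * fps_nth (bernoulli_gf (a / c)) n"
    by (simp only: fps_compose_linear fps_nth_Abs_fps fps_mult_left_const_nth)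
  then show ?thesis
    by (simp add: bernpoly_def mult_ac)
qed

lemma bernpoly_of_real: "bernpoly n (complex_of_real x) = of_real (bernpoly n x)"
proof -
  define G where "G = Abs_fps (\<lambda>n. complex_of_real (fps_nth (bernoulli_gf x) n))"
  have nth: "complex_of_real (fps_nth (bernoulli_gf x * (fps_exp 1 - 1)) n)
      = fps_nth (G * (fps_exp 1 - 1)) n" for n
    by (auto simp: fps_mult_nth G_def intro!: sum.cong)
  have "G * (fps_exp 1 - 1) = fps_X * fps_exp (complex_of_real x)"
    by (rule fps_ext) (simp add: nth [symmetric] bernoulli_gf_exact fps_X_mult_nth)
  from coeff_bernoulli_quotient[OF _ this, of n] show ?thesis
    by (simp add: G_def bernpoly_def)
qed

text \<open>Raabe's multiplication formula. The generating functions on the left add up, by a geometric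
  sum, to \<open>t e\<^bsup>xt/k\<^esup> / (e\<^bsup>t/k\<^esup> - 1)\<close>.\<close>

lemma bernpoly_multiplication:
  fixes x :: "'a::field_char_0"
  assumes "k > 0"
  shows "of_nat k ^ n * (\<Sum>j<k. bernpoly n ((x + of_nat j) / of_nat k)) = of_nat k * bernpoly n x"
proof -
  define u :: 'a where "u = 1 / of_nat k"
  have u0: "u \<noteq> 0" and ku: "of_nat k * u = 1" using assms by (auto simp: u_def)
  define G where "G = (\<Sum>j<k. bernoulli_gf ((x + of_nat j) / of_nat k))"
  define E where "E = fps_exp u"
  have Ek: "E ^ k = fps_exp 1"
    by (simp add: E_def fps_exp_power_mult ku)
  have term_eq: "fps_exp ((x + of_nat j) / of_nat k) = fps_exp (x * u) * E ^ j" for j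
    by (simp add: E_def fps_exp_power_mult fps_exp_add_mult [symmetric] u_def add_divide_distrib)
  have "(G * (E - 1)) * (fps_exp 1 - 1)
      = (\<Sum>j<k. bernoulli_gf ((x + of_nat j) / of_nat k) * (fps_exp 1 - 1)) * (E - 1)"
    by (simp only: G_def sum_distrib_left sum_distrib_right mult_ac)
  also have "\<dots> = fps_X * fps_exp (x * u) * ((E - 1) * (\<Sum>j<k. E ^ j))"
    unfolding bernoulli_gf_exact term_eq
    by (simp only: sum_distrib_left sum_distrib_right mult_ac)
  also have "(E - 1) * (\<Sum>j<k. E ^ j) = fps_exp 1 - 1"
    by (simp add: power_diff_1_eq [symmetric] Ek)
  finally have "G * (E - 1) = fps_X * fps_exp (x * u)"
    by simp
  from coeff_bernoulli_quotient[OF u0 this[unfolded E_def], of n] u0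
  have *: "u * (fact n * fps_nth G n) = u ^ n * bernpoly n x" by simp
  have S: "(\<Sum>j<k. bernpoly n ((x + of_nat j) / of_nat k)) = fact n * fps_nth G n"
    by (simp add: G_def bernpoly_def fps_sum_nth sum_distrib_left)
  have "of_nat k ^ n * (fact n * fps_nth G n)
      = of_nat k ^ n * of_nat k * (u * (fact n * fps_nth G n))"
    using ku by (simp add: mult_ac)
  also have "\<dots> = (of_nat k * u) ^ n * (of_nat k * bernpoly n x)"
    unfolding * by (simp add: power_mult_distrib mult_ac)
  finally show ?thesis using S by (simp add: ku)
qed

lemma bernpoly_plus_one:
  fixes x :: "'a::field_char_0"
  shows "bernpoly (Suc n) (x + 1) = bernpoly (Suc n) x + of_nat (Suc n) * x ^ n"
proof -
  have "(bernoulli_gf (x + 1) - bernoulli_gf x) * (fps_exp 1 - 1)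
      = fps_X * fps_exp (x + 1) - fps_X * fps_exp x"
    by (simp only: left_diff_distrib bernoulli_gf_exact)
  also have "\<dots> = (fps_X * fps_exp x) * (fps_exp 1 - 1)"
    by (simp add: fps_exp_add_mult algebra_simps)
  finally have "(bernoulli_gf (x + 1) - bernoulli_gf x) * (fps_exp 1 - 1)
      = (fps_X * fps_exp x) * (fps_exp 1 - 1)" .
  then have "bernoulli_gf (x + 1) - bernoulli_gf x = fps_X * fps_exp x"
    by simp
  then have "fps_nth (bernoulli_gf (x + 1) - bernoulli_gf x) (Suc n) = x ^ n / fact n"
    by (simp add: fps_X_mult_nth)
  then have "fact (Suc n) * fps_nth (bernoulli_gf (x + 1)) (Suc n)
     = fact (Suc n) * (fps_nth (bernoulli_gf x) (Suc n) + x ^ n / fact n)"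
    by (simp add: algebra_simps)
  also have "\<dots> = fact (Suc n) * fps_nth (bernoulli_gf x) (Suc n) + of_nat (Suc n) * x ^ n"
    by (simp add: distrib_left)
  finally show ?thesis by (simp only: bernpoly_def)
qed

text \<open>Euler's convolution identity. The generating function \<open>G\<close> at \<open>z = x + y\<close> satisfies
  \<open>B(x) B(y) = G - t G' + (z - 1) t G\<close>, where \<open>B(x)\<close> and \<open>B(y)\<close> are the generating functions
  at \<open>x\<close> and \<open>y\<close>.\<close>

lemma bernpoly_convolution:
  fixes x y :: "'a::field_char_0"
  shows "(\<Sum>j = 0..Suc n. of_nat (Suc n choose j) * bernpoly j x * bernpoly (Suc n - j) y)
       = of_nat (Suc n) * (x + y - 1) * bernpoly n (x + y) - of_nat n * bernpoly (Suc n) (x + y)"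
proof -
  define z where "z = x + y"
  define G where "G = bernoulli_gf z"
  define D :: "'a fps" where "D = fps_exp 1 - 1"
  have D0: "D \<noteq> 0" unfolding D_def by simp
  have GD: "G * D = fps_X * fps_exp z" by (simp add: G_def D_def bernoulli_gf_exact)
  have "fps_deriv (G * D) = fps_deriv (fps_X * fps_exp z)" by (simp only: GD)
  then have "fps_deriv G * D + G * (D + 1) = fps_exp z + fps_const z * (fps_X * fps_exp z)"
    by (simp add: D_def mult_ac add_ac)
  then have "fps_X * (fps_deriv G * D + G * (D + 1)) = G * D + fps_X * (fps_const z * (G * D))"
    unfolding GD by (simp add: distrib_left)
  then have XG: "fps_X * G = (G - fps_X * fps_deriv G + fps_const (z - 1) * (fps_X * G)) * D"
    by (simp add: algebra_simps fps_const_sub [symmetric] del: fps_const_sub)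
  have "(bernoulli_gf x * bernoulli_gf y * D) * D
      = (fps_X * fps_exp x) * (fps_X * fps_exp y)"
    by (simp only: D_def bernoulli_gf_exact [symmetric] mult_ac)
  also have "\<dots> = fps_X * (G * D)"
    unfolding GD z_def fps_exp_add_mult by (simp only: mult_ac)
  finally have "bernoulli_gf x * bernoulli_gf y * D = fps_X * G"
    using D0 by (simp add: mult.assoc [symmetric])
  also note XG
  finally have prod: "bernoulli_gf x * bernoulli_gf y
      = G - fps_X * fps_deriv G + fps_const (z - 1) * (fps_X * G)"
    using D0 by (simp only: mult_cancel_right) simp
  have coeff: "fps_nth (bernoulli_gf x * bernoulli_gf y) (Suc n)
      = (z - 1) * fps_nth G n - of_nat n * fps_nth G (Suc n)"
    unfolding prod by (simp add: algebra_simps)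
  have "fact (Suc n) * fps_nth (bernoulli_gf x * bernoulli_gf y) (Suc n)
      = of_nat (Suc n) * (z - 1) * (fact n * fps_nth G n)
        - of_nat n * (fact (Suc n) * fps_nth G (Suc n))"
    unfolding coeff by (simp add: algebra_simps)
  moreover have "fact (Suc n) * fps_nth (bernoulli_gf x * bernoulli_gf y) (Suc n)
      = (\<Sum>j = 0..Suc n. of_nat (Suc n choose j) * bernpoly j x * bernpoly (Suc n - j) y)"
    unfolding fps_mult_nth sum_distrib_left
  proof (rule sum.cong[OF refl])
    fix j assume "j \<in> {0..Suc n}"
    then have "of_nat (fact j * fact (Suc n - j) * (Suc n choose j)) = (of_nat (fact (Suc n)) :: 'a)"
      by (simp only: binomial_fact_lemma atLeastAtMost_iff)
    then have "(fact (Suc n) :: 'a) = of_nat (Suc n choose j) * fact j * fact (Suc n - j)"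
      by (simp only: of_nat_mult of_nat_fact mult_ac)
    then show "fact (Suc n) * (fps_nth (bernoulli_gf x) j * fps_nth (bernoulli_gf y) (Suc n - j))
        = of_nat (Suc n choose j) * bernpoly j x * bernpoly (Suc n - j) y"
      by (simp only: bernpoly_def mult_ac)
  qed
  ultimately show ?thesis by (simp add: G_def z_def bernpoly_def)
qed

section \<open>Bernoulli functions\<close>

lemma sum_residues_permute:
  fixes F :: "int \<Rightarrow> 'a::comm_monoid_add"
  assumes "k > 0" and per: "\<And>x. F (x mod int k) = F x"
    and inj: "\<And>i j. i < k \<Longrightarrow> j < k \<Longrightarrow> h i mod int k = h j mod int k \<Longrightarrow> i = j"
  shows "(\<Sum>j<k. F (h j)) = (\<Sum>j<k. F (int j))"
proof -
  define r where "r j = nat (h j mod int k)" for j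
  have r: "int (r j) = h j mod int k" for j
    using assms(1) by (simp add: r_def)
  have "inj_on r {..<k}"
    by (rule inj_onI) (metis inj lessThan_iff r)
  moreover have "r ` {..<k} \<subseteq> {..<k}"
  proof safe
    fix j
    have "int (r j) < int k" using assms(1) by (simp add: r)
    then show "r j < k" by simp
  qed
  ultimately have "bij_betw r {..<k} {..<k}"
    by (simp add: bij_betw_def endo_inj_surj)
  then have "(\<Sum>j<k. F (int (r j))) = (\<Sum>j<k. F (int j))"
    by (rule sum.reindex_bij_betw)
  then show ?thesis by (simp add: r per)
qed

lemma bernoulli_fun_add_int: "bernoulli_fun n (x + of_int m) = bernoulli_fun n x"
  by (simp add: bernoulli_fun_def)

lemma bernoulli_fun_eq_bernpoly:
  "n \<noteq> 1 \<Longrightarrow> 0 \<le> x \<Longrightarrow> x < 1 \<Longrightarrow> bernoulli_fun n x = bernpoly n x"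
proof -
  assume "n \<noteq> 1" "0 \<le> x" "x < 1"
  moreover from this have "\<lfloor>x\<rfloor> = 0" by (simp add: floor_eq_iff)
  ultimately show ?thesis by (simp add: bernoulli_fun_def)
qed

lemma bernoulli_fun_one: "0 < x \<Longrightarrow> x < 1 \<Longrightarrow> bernoulli_fun 1 x = x - 1 / 2"
proof -
  assume x: "0 < x" "x < 1"
  then have "\<lfloor>x\<rfloor> = 0" by (simp add: floor_eq_iff)
  moreover from x have "x \<notin> \<int>" by (auto elim!: Ints_cases)
  ultimately show ?thesis by (simp add: bernoulli_fun_def)
qed

lemma periodic_mod_fraction:
  fixes f :: "real \<Rightarrow> 'a"
  assumes "k > 0" and per: "\<And>x m. f (x + of_int m) = f x"
  shows "f (w + of_int (i mod int k) / real k) = f (w + of_int i / real k)"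
proof -
  have "real_of_int i = of_int (int k * (i div int k) + i mod int k)" by simp
  also have "\<dots> = real k * of_int (i div int k) + of_int (i mod int k)"
    by (simp only: of_int_add of_int_mult of_int_of_nat_eq)
  finally have "w + of_int i / real k = (w + of_int (i mod int k) / real k) + of_int (i div int k)"
    using assms(1) by (simp add: add_divide_distrib)
  then show ?thesis by (simp only: per)
qed

text \<open>The condition \<open>n \<noteq> 1\<close> keeps clear of the value \<open>0\<close> at integers, which is special to \<open>n = 1\<close>.\<close>

lemma bernoulli_fun_multiplication:
  assumes "k > 0" and "n \<noteq> 1"
  shows "real k ^ n * (\<Sum>j<k. bernoulli_fun n ((x + real j) / real k)) = real k * bernoulli_fun n x"
proof -
  define y where "y = x - of_int \<lfloor>x\<rfloor>"
  have y: "0 \<le> y" "y < 1" and xy: "x = y + of_int \<lfloor>x\<rfloor>"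
    by (simp_all add: y_def floor_le_iff) linarith
  \<comment> \<open>Shifting the summation index by the floor of \<open>x\<close> reduces to an argument in \<open>[0,1)\<close>.\<close>
  have "(\<Sum>j<k. bernoulli_fun n ((x + real j) / real k))
      = (\<Sum>j<k. bernoulli_fun n (y / real k + of_int (\<lfloor>x\<rfloor> + int j) / real k))"
    by (intro sum.cong refl arg_cong[where f = "bernoulli_fun n"])
       (simp add: y_def diff_divide_distrib add_divide_distrib)
  also have "\<dots> = (\<Sum>j<k. bernoulli_fun n (y / real k + of_int (int j) / real k))"
  proof (rule sum_residues_permute)
    fix i j assume ij: "i < k" "j < k" "(\<lfloor>x\<rfloor> + int i) mod int k = (\<lfloor>x\<rfloor> + int j) mod int k"
    then have "int k dvd (\<lfloor>x\<rfloor> + int i) - (\<lfloor>x\<rfloor> + int j)" by (simp only: mod_eq_dvd_iff)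
    then have "int k dvd int i - int j" by simp
    then have "int i mod int k = int j mod int k" by (simp only: mod_eq_dvd_iff)
    then show "i = j" using ij by simp
  qed (use assms(1) in \<open>auto intro!: periodic_mod_fraction bernoulli_fun_add_int\<close>)
  also have "\<dots> = (\<Sum>j<k. bernpoly n ((y + real j) / real k))"
  proof (rule sum.cong[OF refl])
    fix j assume "j \<in> {..<k}"
    then have "y + real j < real k" using y by (simp add: nat_less_real_le)
    with y show "bernoulli_fun n (y / real k + of_int (int j) / real k) = bernpoly n ((y + real j) / real k)"
      using assms by (simp add: add_divide_distrib [symmetric] bernoulli_fun_eq_bernpoly)
  qed
  finally show ?thesis
    using bernpoly_multiplication[OF assms(1), of n y] assms(2)
    by (simp add: bernoulli_fun_def y_def)
qed

text \<open>For \<open>x + y \<ge> 1\<close>, put \<open>z = x + y - 1\<close>. Passing from polynomials to periodic functions subtracts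
  \<open>(p + 1) z * p z\<^bsup>p-1\<^esup>\<close> from the first term and \<open>p * (p + 1) z\<^sup>p\<close> from the second, and these agree.\<close>

lemma bernpoly_convolution_periodic:
  assumes "p > 1" and "0 < x" "x < 1" "0 < y" "y < 1"
  shows "(\<Sum>j = 0..p + 1. of_nat ((p + 1) choose j) * bernpoly j x * bernpoly (p + 1 - j) y)
       = real (p + 1) * (bernoulli_fun p (x + y) * (bernoulli_fun 1 x + bernoulli_fun 1 y))
         - real p * bernoulli_fun (p + 1) (x + y)"
proof -
  have lin: "bernoulli_fun 1 x + bernoulli_fun 1 y = x + y - 1"
    using assms bernoulli_fun_one[of x] bernoulli_fun_one[of y] by linarith
  have conv: "(\<Sum>j = 0..p + 1. of_nat ((p + 1) choose j) * bernpoly j x * bernpoly (p + 1 - j) y)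
      = real (p + 1) * (x + y - 1) * bernpoly p (x + y) - real p * bernpoly (p + 1) (x + y)"
    using bernpoly_convolution[of p x y] by simp
  show ?thesis
  proof (cases "x + y < 1")
    case True
    then show ?thesis
      using assms unfolding conv lin by (simp add: bernoulli_fun_eq_bernpoly)
  next
    case False
    define z where "z = x + y - 1"
    obtain m where p: "p = Suc m" using assms(1) by (cases p) auto
    have z: "0 \<le> z" "z < 1" "x + y = z + 1" using False assms by (auto simp: z_def)
    have shift: "bernoulli_fun n (z + 1) = bernpoly n z" if "n \<noteq> 1" for n
      using bernoulli_fun_add_int[of n z 1] bernoulli_fun_eq_bernpoly[OF that z(1,2)] by simp
    have sh: "bernoulli_fun p (z + 1) = bernpoly p z"
      "bernoulli_fun (p + 1) (z + 1) = bernpoly (p + 1) z"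
      using assms(1) by (auto intro!: shift)
    have diff: "bernpoly p (z + 1) = bernpoly p z + real p * z ^ m"
      "bernpoly (p + 1) (z + 1) = bernpoly (p + 1) z + real (p + 1) * (z * z ^ m)"
      using bernpoly_plus_one[of m z] bernpoly_plus_one[of p z] by (simp_all add: p)
    show ?thesis
      unfolding conv lin z(3) sh diff by (simp add: algebra_simps)
  qed
qed

section \<open>Sums over residue classes weighted by a character\<close>

lemma periodic_add_multiple:
  fixes \<chi> :: "int \<Rightarrow> 'a"
  assumes "\<And>n. \<chi> (n + int k) = \<chi> n"
  shows "\<chi> (int (h + k * t)) = \<chi> (int h)"
proof (induction t)
  case (Suc t)
  then show ?case using assms[of "int (h + k * t)"] by (simp add: algebra_simps)
qed simp

lemma sum_split_residues:
  fixes G :: "nat \<Rightarrow> 'a::comm_monoid_add"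
  shows "(\<Sum>m<c * k. G m) = (\<Sum>h<k. \<Sum>t<c. G (h + k * t))"
proof -
  have "(\<Sum>m<c * k. G m) = (\<Sum>t<c. sum G {t * k..<t * k + k})"
    by (rule sum.nat_group [symmetric])
  also have "\<dots> = (\<Sum>t<c. \<Sum>h<k. G (h + k * t))"
  proof (rule sum.cong[OF refl])
    fix t
    show "sum G {t * k..<t * k + k} = (\<Sum>h<k. G (h + k * t))"
      using sum.shift_bounds_nat_ivl[of G 0 "t * k" k]
      by (simp add: add.commute mult.commute atLeast0LessThan)
  qed
  finally show ?thesis by (subst sum.swap)
qed

lemma sum_periodic_split:
  fixes \<chi> :: "int \<Rightarrow> 'a::comm_semiring_0"
  assumes "\<And>n. \<chi> (n + int k) = \<chi> n"
  shows "(\<Sum>m<c * k. \<chi> (int m) * G m) = (\<Sum>h<k. \<chi> (int h) * (\<Sum>t<c. G (h + k * t)))"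
  using periodic_add_multiple[of \<chi>, OF assms]
  by (simp only: sum_split_residues sum_distrib_left)

text \<open>Any function obeying the multiplication formula may be used for \<open>f\<close>: a Bernoulli function with
  a shift \<open>y\<close>, or a Bernoulli polynomial with \<open>y = 0\<close>.\<close>

lemma character_sum_multiplication:
  fixes f :: "'b::field_char_0 \<Rightarrow> complex" and \<chi> :: "int \<Rightarrow> complex"
  assumes "b > 0" "k > 0" and per: "\<And>n. \<chi> (n + int k) = \<chi> n"
    and mult: "\<And>x. of_nat b ^ n * (\<Sum>j<b. f ((x + of_nat j) / of_nat b)) = of_nat b * f x"
  shows "of_nat b ^ n * (\<Sum>m<b * k. \<chi> (int m) * f (of_nat m / of_nat (b * k) + y))
       = of_nat b * (\<Sum>h<k. \<chi> (int h) * f (of_nat h / of_nat k + of_nat b * y))"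
proof -
  have arg: "of_nat (h + k * t) / of_nat (b * k) + y
      = (of_nat h / of_nat k + of_nat b * y + of_nat t) / (of_nat b :: 'b)" for h t
    using assms(1,2) by (simp add: field_simps)
  have "of_nat b ^ n * (\<Sum>m<b * k. \<chi> (int m) * f (of_nat m / of_nat (b * k) + y))
      = (\<Sum>h<k. \<chi> (int h) * (of_nat b ^ n *
          (\<Sum>t<b. f ((of_nat h / of_nat k + of_nat b * y + of_nat t) / of_nat b))))"
    by (simp only: sum_periodic_split[of \<chi>, OF per] arg sum_distrib_left mult.left_commute)
  also have "\<dots> = of_nat b * (\<Sum>h<k. \<chi> (int h) * f (of_nat h / of_nat k + of_nat b * y))"
    unfolding mult by (simp only: sum_distrib_left mult.left_commute)
  finally show ?thesis .
qed

lemma bernoulli_fun_multiplication_complex: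
  assumes "k > 0" and "n \<noteq> 1"
  shows "of_nat k ^ n * (\<Sum>j<k. complex_of_real (bernoulli_fun n ((x + of_nat j) / of_nat k)))
       = of_nat k * of_real (bernoulli_fun n x)"
  using arg_cong[OF bernoulli_fun_multiplication[OF assms, of x], of complex_of_real] by simp

lemma bernoulli_fun_sum_coprime:
  assumes "c > 0" "coprime b c" "n \<noteq> 1"
  shows "real c ^ n * (\<Sum>s<c. bernoulli_fun n (real (b * s) / real c + w))
       = real c * bernoulli_fun n (real c * w)"
proof -
  have "(\<Sum>s<c. bernoulli_fun n (real (b * s) / real c + w))
      = (\<Sum>s<c. bernoulli_fun n (w + of_int (int (b * s)) / real c))"
    by (simp add: add.commute)
  also have "\<dots> = (\<Sum>s<c. bernoulli_fun n (w + of_int (int s) / real c))"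
  proof (rule sum_residues_permute)
    fix i j assume ij: "i < c" "j < c" "int (b * i) mod int c = int (b * j) mod int c"
    then have "int c dvd int b * (int i - int j)"
      by (simp add: mod_eq_dvd_iff right_diff_distrib)
    moreover have "coprime (int c) (int b)" using assms(2) by (simp add: coprime_commute)
    ultimately have "int c dvd int i - int j" by (simp add: coprime_dvd_mult_right_iff)
    then have "int i mod int c = int j mod int c" by (simp only: mod_eq_dvd_iff)
    then show "i = j" using ij by simp
  qed (use assms(1) in \<open>auto intro!: periodic_mod_fraction bernoulli_fun_add_int\<close>)
  also have "\<dots> = (\<Sum>s<c. bernoulli_fun n ((real c * w + real s) / real c))"
    using assms(1) by (intro sum.cong refl arg_cong[where f = "bernoulli_fun n"])
      (simp add: field_simps)
  finally show ?thesis
    using bernoulli_fun_multiplication[OF assms(1,3), of "real c * w"] by simp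
qed

text \<open>Over \<open>q\<close> full periods modulo \<open>c\<close> the sum is repeated \<open>q\<close> times.\<close>

lemma bernoulli_fun_sum_gcd:
  assumes "c > 0" "coprime b c" "n \<noteq> 1"
  shows "real c ^ n * (\<Sum>s<q * c. bernoulli_fun n (real (b * s) / real c + w))
       = real q * real c * bernoulli_fun n (real c * w)"
proof -
  have "bernoulli_fun n (real (b * (h + c * t)) / real c + w)
      = bernoulli_fun n (real (b * h) / real c + w)" for h t
    using bernoulli_fun_add_int[of n "real (b * h) / real c + w" "int (b * t)"] assms(1)
    by (simp add: field_simps)
  then have "(\<Sum>s<q * c. bernoulli_fun n (real (b * s) / real c + w))
      = real q * (\<Sum>s<c. bernoulli_fun n (real (b * s) / real c + w))"
    by (simp add: sum_split_residues sum_distrib_left)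
  then show ?thesis using bernoulli_fun_sum_coprime[OF assms, of w] by simp
qed

text \<open>The parameters \<open>b\<close> and \<open>c\<close> are coprime and stand for the original ones divided by their greatest
  common divisor \<open>q\<close>, whence the summation range \<open>q c k\<close>.\<close>

lemma character_sum_multiplication_gcd:
  fixes \<chi> :: "int \<Rightarrow> complex"
  assumes "c > 0" "coprime b c" "n \<noteq> 1" "k > 0" and per: "\<And>n. \<chi> (n + int k) = \<chi> n"
  shows "of_nat c ^ n * (\<Sum>m<(q * c) * k. \<chi> (int m) *
            of_real (bernoulli_fun n (real (b * m) / real (c * k) + y)))
       = of_nat q * of_nat c * (\<Sum>h<k. \<chi> (int h) *
            of_real (bernoulli_fun n (real (b * h) / real k + real c * y)))"
proof -
  have arg: "real (b * (h + k * t)) / real (c * k) + y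
      = real (b * t) / real c + (real (b * h) / real (c * k) + y)" for h t
    using assms by (simp add: field_simps)
  have arg': "real c * (real (b * h) / real (c * k) + y) = real (b * h) / real k + real c * y" for h
    using assms by (simp add: field_simps)
  have G: "of_nat c ^ n * (\<Sum>s<q * c. complex_of_real (bernoulli_fun n (real (b * s) / real c + w)))
      = of_nat q * of_nat c * of_real (bernoulli_fun n (real c * w))" for w
    using arg_cong[OF bernoulli_fun_sum_gcd[OF assms(1-3), of w q], of complex_of_real] by simp
  have "of_nat c ^ n * (\<Sum>m<(q * c) * k. \<chi> (int m) *
            of_real (bernoulli_fun n (real (b * m) / real (c * k) + y)))
      = (\<Sum>h<k. \<chi> (int h) * (of_nat c ^ n * (\<Sum>s<q * c. complex_of_real
          (bernoulli_fun n (real (b * s) / real c + (real (b * h) / real (c * k) + y))))))"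
    by (simp only: sum_periodic_split[of \<chi>, OF per] arg sum_distrib_left mult.left_commute)
  also have "\<dots> = of_nat q * of_nat c * (\<Sum>h<k. \<chi> (int h) *
            of_real (bernoulli_fun n (real (b * h) / real k + real c * y)))"
    unfolding G arg' by (simp only: sum_distrib_left mult.left_commute)
  finally show ?thesis .
qed

section \<open>Generalized Bernoulli numbers and functions\<close>

text \<open>The value at \<open>0\<close> is nonzero only for modulus \<open>1\<close>, where the character is constantly \<open>1\<close>, hence
  principal.\<close>

lemma nonprincipal_character_zero:
  assumes "dirichlet_character k \<chi>" and "\<chi> \<noteq> principal_character k"
  shows "\<chi> 0 = 0"
proof (rule ccontr)
  assume "\<chi> 0 \<noteq> 0"
  with assms(1) have k: "k = 1" by (auto simp: dirichlet_character_def)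
  have m: "\<chi> (m * n) = \<chi> m * \<chi> n" and nz: "\<chi> n \<noteq> 0" for m n
    using assms(1) k by (auto simp: dirichlet_character_def)
  have "\<chi> n = 1" for n
    using m[of 0 n] nz[of 0] by simp
  with assms(2) k show False by (auto simp: principal_character_def)
qed

text \<open>The factor \<open>b * k\<close> in the argument is the one in the definition of the Dedekind sum, whose
  arguments are \<open>b * k\<^sub>2\<close> times \<open>n / (c * k\<^sub>1)\<close>.\<close>

lemma gen_bernoulli_fun_distribution:
  assumes "b > 0" "k > 0" "p > 1" "\<chi> 0 = 0" and per: "\<And>n. \<chi> (n + int k) = \<chi> n"
  shows "gen_bernoulli_fun p k \<chi> (real (b * k) * y)
       = of_nat (b * k) ^ (p - 1) *
         (\<Sum>m<b * k. cnj (\<chi> (int m)) * of_real (bernoulli_fun p (real m / real (b * k) + y)))"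
proof -
  obtain r where p: "p = Suc r" using assms(3) by (cases p) auto
  have "{..<k} = insert 0 {1..k - 1}" using assms(2) by auto
  then have "(\<Sum>h<k. cnj (\<chi> (int h)) * of_real (bernoulli_fun p (real h / real k + real b * y)))
      = (\<Sum>h = 1..k - 1. cnj (\<chi> (int h)) * complex_of_real (bernoulli_fun p (real h / real k + real b * y)))"
    using assms(4) by simp
  also have "\<dots> = (\<Sum>h = 1..k - 1. cnj (\<chi> (int h)) *
      complex_of_real (bernoulli_fun p ((real h + real (b * k) * y) / real k)))"
    using assms(2) by (simp add: add_divide_distrib)
  finally have g: "gen_bernoulli_fun p k \<chi> (real (b * k) * y) = of_nat k ^ r *
      (\<Sum>h<k. cnj (\<chi> (int h)) * of_real (bernoulli_fun p (real h / real k + real b * y)))"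
    by (simp add: gen_bernoulli_fun_def p)
  have "of_nat b ^ p * (\<Sum>m<b * k. cnj (\<chi> (int m)) *
          complex_of_real (bernoulli_fun p (of_nat m / of_nat (b * k) + y)))
      = of_nat b * (\<Sum>h<k. cnj (\<chi> (int h)) *
          complex_of_real (bernoulli_fun p (of_nat h / of_nat k + of_nat b * y)))"
    by (rule character_sum_multiplication[of b k "\<lambda>n. cnj (\<chi> n)"])
       (use assms bernoulli_fun_multiplication_complex[of b p] in auto)
  then have "of_nat b ^ r * (\<Sum>m<b * k. cnj (\<chi> (int m)) *
          complex_of_real (bernoulli_fun p (real m / real (b * k) + y)))
      = (\<Sum>h<k. cnj (\<chi> (int h)) *
          complex_of_real (bernoulli_fun p (real h / real k + real b * y)))"
    using assms(1) by (simp add: p)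
  then show ?thesis
    unfolding g by (simp add: p power_mult_distrib mult_ac)
qed

lemma gen_bernoulli_distribution:
  assumes "b > 0" "k > 0" and per: "\<And>n. \<chi> (n + int k) = \<chi> n"
  shows "of_nat (b * k) * gen_bernoulli n k \<chi>
       = of_nat (b * k) ^ n * (\<Sum>m<b * k. cnj (\<chi> (int m)) * of_real (bernpoly n (real m / real (b * k))))"
proof -
  define G where "G a = fps_X * fps_exp (of_nat a) / (fps_exp (of_nat k) - 1 :: complex fps)" for a
  have dvd: "fps_exp (of_nat k) - 1 dvd fps_X * (f :: complex fps)" for f
    using assms(2) by (intro fps_exp_minus_one_dvd) simp
  have co: "of_nat k * (fact n * fps_nth (G a) n) = of_nat k ^ n * bernpoly n (of_nat a / of_nat k)" for a
    using assms(2) by (intro coeff_bernoulli_quotient) (simp_all add: G_def dvd)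
  have "fps_const z * fps_X * fps_exp (of_nat a + 0) / (fps_exp (of_nat k) - 1) = fps_const z * G a"
    for z a
    by (simp add: G_def mult.assoc div_mult_swap dvd)
  then have "gen_bernoulli n k \<chi> = (\<Sum>a = 0..k - 1. cnj (\<chi> (int a)) * (fact n * fps_nth (G a) n))"
    unfolding gen_bernoulli_def gen_bernpoly_def gen_bernoulli_gf_def
    by (simp add: fps_sum_nth sum_distrib_left mult.left_commute)
  also have "{0..k - 1} = {..<k}" using assms(2) by auto
  finally have "of_nat k * gen_bernoulli n k \<chi>
      = (\<Sum>a<k. cnj (\<chi> (int a)) * (of_nat k * (fact n * fps_nth (G a) n)))"
    by (simp only: sum_distrib_left mult.left_commute)
  then have g: "of_nat k * gen_bernoulli n k \<chi>
      = of_nat k ^ n * (\<Sum>a<k. cnj (\<chi> (int a)) * bernpoly n (of_nat a / of_nat k))"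
    unfolding co by (simp only: sum_distrib_left mult.left_commute)
  have "of_nat b ^ n * (\<Sum>m<b * k. cnj (\<chi> (int m)) * bernpoly n (of_nat m / of_nat (b * k) + 0 :: complex))
      = of_nat b * (\<Sum>h<k. cnj (\<chi> (int h)) * bernpoly n (of_nat h / of_nat k + of_nat b * 0 :: complex))"
    by (rule character_sum_multiplication[of b k "\<lambda>n. cnj (\<chi> n)"])
       (use assms bernpoly_multiplication[of b n] in auto)
  then have "of_nat b * (of_nat k * gen_bernoulli n k \<chi>) = of_nat k ^ n * (of_nat b ^ n *
      (\<Sum>m<b * k. cnj (\<chi> (int m)) * bernpoly n (of_nat m / of_nat (b * k))))"
    unfolding g by (simp add: mult_ac)
  moreover have "(of_nat m / of_nat (b * k) :: complex) = of_real (real m / real (b * k))" for m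
    by simp
  ultimately show ?thesis
    by (simp only: bernpoly_of_real of_nat_mult power_mult_distrib mult_ac)
qed

lemma char_dedekind_sum_eq:
  assumes "b > 0" "k2 > 0" "c > 0" "k1 > 0" "p > 1" "\<chi>2 0 = 0" and per: "\<And>n. \<chi>2 (n + int k2) = \<chi>2 n"
  shows "char_dedekind_sum p b c k1 \<chi>1 k2 \<chi>2 = of_nat (b * k2) ^ (p - 1) *
     (\<Sum>n<c * k1. \<Sum>m<b * k2. \<chi>1 (int n) * cnj (\<chi>2 (int m)) *
        of_real (bernoulli_fun p (real n / real (c * k1) + real m / real (b * k2))
               * bernoulli_fun 1 (real n / real (c * k1))))"
proof -
  obtain r where "c * k1 = Suc r" using assms by (cases "c * k1") auto
  then have set: "{0..c * k1 - 1} = {..<c * k1}" by auto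
  have arg: "real (n * b * k2) / real (c * k1) = real (b * k2) * (real n / real (c * k1))" for n
    by simp
  show ?thesis
    unfolding char_dedekind_sum_def set arg
      gen_bernoulli_fun_distribution[of b k2 p \<chi>2, OF assms(1,2,5,6) per]
    by (simp add: sum_distrib_left sum_distrib_right mult_ac add_ac)
qed

theorem theorem2:
  fixes b c q p k1 k2 :: nat and \<chi>1 \<chi>2 :: "int \<Rightarrow> complex"
  assumes "b > 0" and "c > 0" and "q = gcd b c" and "p > 1"
    and "primitive_character k1 \<chi>1" and "\<chi>1 \<noteq> principal_character k1"
    and "primitive_character k2 \<chi>2" and "\<chi>2 \<noteq> principal_character k2"
    and "(-1) ^ (p + 1) * \<chi>1 (-1) * \<chi>2 (-1) = 1"
  shows "of_nat (p + 1) *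
           (of_nat (b * k2) * of_nat (c * k1) ^ p * char_dedekind_sum p b c k1 \<chi>1 k2 \<chi>2
            + of_nat (c * k1) * of_nat (b * k2) ^ p
                * char_dedekind_sum p c b k2 (conj_char \<chi>2) k1 (conj_char \<chi>1))
         = (\<Sum>j = 0..p + 1. of_nat ((p + 1) choose j) * of_nat (b * k2) ^ j
                * of_nat (c * k1) ^ (p + 1 - j)
                * gen_bernoulli j k1 (conj_char \<chi>1) * gen_bernoulli (p + 1 - j) k2 \<chi>2)
           + of_nat p * of_nat q ^ (p + 1) * of_nat (k1 * k2) ^ p
             * (\<Sum>h = 1..k1. \<Sum>j = 1..k2. \<chi>1 (int h) * conj_char \<chi>2 (int j)
                  * of_real (bernoulli_fun (p + 1)
                      (real (c * j) / real (q * k2) + real (b * h) / real (q * k1))))"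
proof -
  define \<psi> where "\<psi> = conj_char \<chi>2"
  define M where "M = b * k2"
  define N where "N = c * k1"
  define x where "x n = real n / real N" for n
  define y where "y m = real m / real M" for m
  have D: "dirichlet_character k1 \<chi>1" "dirichlet_character k2 \<chi>2"
    using assms by (auto simp: primitive_character_def)
  have k: "k1 > 0" "k2 > 0" and per1: "\<And>n. \<chi>1 (n + int k1) = \<chi>1 n"
    and per2: "\<And>n. \<chi>2 (n + int k2) = \<chi>2 n"
    using D by (auto simp: dirichlet_character_def)
  have zero: "\<chi>1 0 = 0" "\<chi>2 0 = 0"
    using nonprincipal_character_zero D assms by auto
  have MN: "M > 0" "N > 0" using assms k by (auto simp: M_def N_def)
  \<comment> \<open>The linear functional to which every sum in the statement is reduced; by \<open>T_cong\<close> it ignores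
    the values at \<open>n = 0\<close> and \<open>m = 0\<close>.\<close>
  define T where "T F = (\<Sum>n<N. \<Sum>m<M. \<chi>1 (int n) * \<psi> (int m) * of_real (F n m))"
    for F :: "nat \<Rightarrow> nat \<Rightarrow> real"
  have T_cong: "T F = T G"
    if "\<And>n m. 0 < n \<Longrightarrow> n < N \<Longrightarrow> 0 < m \<Longrightarrow> m < M \<Longrightarrow> F n m = G n m" for F G
    unfolding T_def
  proof (intro sum.cong refl)
    fix n m assume "n \<in> {..<N}" "m \<in> {..<M}"
    then show "\<chi>1 (int n) * \<psi> (int m) * of_real (F n m) = \<chi>1 (int n) * \<psi> (int m) * of_real (G n m)"
      using zero that by (cases "n = 0"; cases "m = 0") (auto simp: \<psi>_def conj_char_def)
  qed
  have T_add: "T (\<lambda>n m. F n m + G n m) = T F + T G" for F G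
    by (simp add: T_def sum.distrib distrib_left)
  have T_diff: "T (\<lambda>n m. F n m - G n m) = T F - T G" for F G
    by (simp add: T_def sum_subtractf right_diff_distrib)
  have T_scale: "T (\<lambda>n m. r * F n m) = of_real r * T F" for r F
    by (simp add: T_def sum_distrib_left mult_ac)
  have T_sum: "T (\<lambda>n m. \<Sum>j\<in>J. F j n m) = (\<Sum>j\<in>J. T (F j))" if "finite J" for J and F :: "nat \<Rightarrow> _"
    using that by (induction J rule: finite_induct) (simp_all add: T_add, simp add: T_def)
  have S1: "of_nat M * of_nat N ^ p * char_dedekind_sum p b c k1 \<chi>1 k2 \<chi>2
      = of_nat (N * M) ^ p * T (\<lambda>n m. bernoulli_fun p (x n + y m) * bernoulli_fun 1 (x n))"
  proof -
    have "char_dedekind_sum p b c k1 \<chi>1 k2 \<chi>2 = of_nat M ^ (p - 1) *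
        T (\<lambda>n m. bernoulli_fun p (x n + y m) * bernoulli_fun 1 (x n))"
      using char_dedekind_sum_eq[of b k2 c k1 p \<chi>2 \<chi>1] assms k zero per2
      by (simp add: T_def M_def N_def x_def y_def \<psi>_def conj_char_def)
    moreover have "of_nat M * of_nat M ^ (p - 1) = (of_nat M ^ p :: complex)"
      using assms(4) by (simp flip: power_Suc)
    ultimately show ?thesis by (simp add: power_mult_distrib mult_ac)
  qed
  have S2: "of_nat N * of_nat M ^ p * char_dedekind_sum p c b k2 \<psi> k1 (conj_char \<chi>1)
      = of_nat (N * M) ^ p * T (\<lambda>n m. bernoulli_fun p (x n + y m) * bernoulli_fun 1 (y m))"
  proof -
    have "char_dedekind_sum p c b k2 \<psi> k1 (conj_char \<chi>1) = of_nat N ^ (p - 1) *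
        (\<Sum>m<M. \<Sum>n<N. \<psi> (int m) * \<chi>1 (int n) *
          of_real (bernoulli_fun p (y m + x n) * bernoulli_fun 1 (y m)))"
      using char_dedekind_sum_eq[of c k1 b k2 p "conj_char \<chi>1" \<psi>] assms k zero per1
      by (simp add: M_def N_def x_def y_def conj_char_def)
    also have "\<dots> = of_nat N ^ (p - 1) *
        T (\<lambda>n m. bernoulli_fun p (x n + y m) * bernoulli_fun 1 (y m))"
      unfolding T_def by (subst sum.swap) (simp only: mult_ac add.commute)
    finally have "char_dedekind_sum p c b k2 \<psi> k1 (conj_char \<chi>1) = of_nat N ^ (p - 1) *
        T (\<lambda>n m. bernoulli_fun p (x n + y m) * bernoulli_fun 1 (y m))" .
    moreover have "of_nat N * of_nat N ^ (p - 1) = (of_nat N ^ p :: complex)"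
      using assms(4) by (simp flip: power_Suc)
    ultimately show ?thesis by (simp add: power_mult_distrib mult_ac)
  qed
  have conv: "(\<Sum>j = 0..p + 1. of_nat ((p + 1) choose j) * of_nat M ^ j
        * of_nat N ^ (p + 1 - j) * gen_bernoulli j k1 (conj_char \<chi>1) * gen_bernoulli (p + 1 - j) k2 \<chi>2)
      = of_nat (N * M) ^ p * T (\<lambda>n m. \<Sum>j = 0..p + 1. of_nat ((p + 1) choose j)
          * bernpoly j (x n) * bernpoly (p + 1 - j) (y m))" (is "?L = _ * ?R")
  proof -
    have B1: "of_nat N * gen_bernoulli j k1 (conj_char \<chi>1)
        = of_nat N ^ j * (\<Sum>n<N. \<chi>1 (int n) * of_real (bernpoly j (x n)))" for j
      using gen_bernoulli_distribution[of c k1 "conj_char \<chi>1" j] assms k per1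
      by (simp add: N_def x_def conj_char_def)
    have B2: "of_nat M * gen_bernoulli j k2 \<chi>2
        = of_nat M ^ j * (\<Sum>m<M. \<psi> (int m) * of_real (bernpoly j (y m)))" for j
      using gen_bernoulli_distribution[of b k2 \<chi>2 j] assms k per2
      by (simp add: M_def y_def conj_char_def \<psi>_def)
    have "of_nat (N * M) * ?L = (\<Sum>j = 0..p + 1. of_nat ((p + 1) choose j) * of_nat M ^ j
        * of_nat N ^ (p + 1 - j) * (of_nat N * gen_bernoulli j k1 (conj_char \<chi>1))
        * (of_nat M * gen_bernoulli (p + 1 - j) k2 \<chi>2))"
      by (simp only: sum_distrib_left of_nat_mult mult_ac)
    also have "\<dots> = (\<Sum>j = 0..p + 1. of_nat (N * M) ^ (p + 1) *
        T (\<lambda>n m. of_nat ((p + 1) choose j) * bernpoly j (x n) * bernpoly (p + 1 - j) (y m)))"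
    proof (rule sum.cong[OF refl])
      fix j assume j: "j \<in> {0..p + 1}"
      have pw: "z ^ j * z ^ (p + 1 - j) = z ^ (p + 1)" for z :: complex
        using j by (simp flip: power_add)
      have T': "T (\<lambda>n m. of_nat ((p + 1) choose j) * bernpoly j (x n) * bernpoly (p + 1 - j) (y m))
          = of_nat ((p + 1) choose j) * ((\<Sum>n<N. \<chi>1 (int n) * of_real (bernpoly j (x n))) *
             (\<Sum>m<M. \<psi> (int m) * of_real (bernpoly (p + 1 - j) (y m))))"
        unfolding T_def sum_product by (simp add: sum_distrib_left mult_ac)
      show "of_nat ((p + 1) choose j) * of_nat M ^ j
          * of_nat N ^ (p + 1 - j) * (of_nat N * gen_bernoulli j k1 (conj_char \<chi>1))
          * (of_nat M * gen_bernoulli (p + 1 - j) k2 \<chi>2) = of_nat (N * M) ^ (p + 1) *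
        T (\<lambda>n m. of_nat ((p + 1) choose j) * bernpoly j (x n) * bernpoly (p + 1 - j) (y m))"
        unfolding B1 B2 T' of_nat_mult power_mult_distrib pw [symmetric] by (simp only: mult_ac)
    qed
    also have "\<dots> = of_nat (N * M) * (of_nat (N * M) ^ p * ?R)"
      by (simp only: T_sum finite_atLeastAtMost sum_distrib_left power_add power_one_right mult_ac)
    finally show ?thesis using MN by simp
  qed
  have last: "of_nat (N * M) ^ p * T (\<lambda>n m. bernoulli_fun (p + 1) (x n + y m))
      = of_nat q ^ (p + 1) * of_nat (k1 * k2) ^ p
          * (\<Sum>h = 1..k1. \<Sum>j = 1..k2. \<chi>1 (int h) * \<psi> (int j)
              * of_real (bernoulli_fun (p + 1)
                  (real (c * j) / real (q * k2) + real (b * h) / real (q * k1))))"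
    (is "_ = _ * _ * ?H")
  proof -
    define f where "f z = complex_of_real (bernoulli_fun (p + 1) z)" for z
    have q: "q > 0" using assms by simp
    define b' where "b' = b div q"
    define c' where "c' = c div q"
    have bc: "b = q * b'" "c = q * c'" "coprime b' c'"
      using assms(1,3) by (simp_all add: b'_def c'_def div_gcd_coprime)
    have c': "c' > 0" using assms(2) bc(2) by (cases c') auto
    have per: "\<psi> (n + int k2) = \<psi> n" for n by (simp add: \<psi>_def conj_char_def per2)
    \<comment> \<open>The multiplication formula modulo \<open>b\<close> for the sum over \<open>m\<close>, then modulo \<open>c' = c/q\<close> for the
      sum over \<open>n\<close>.\<close>
    have "of_nat b ^ (p + 1) * (\<Sum>m<M. \<psi> (int m) * f (y m + x n))
        = of_nat b * (\<Sum>j<k2. \<psi> (int j) * f (real j / real k2 + real b * x n))" for n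
      unfolding M_def y_def f_def
      by (rule character_sum_multiplication)
         (use assms(1,4) k per bernoulli_fun_multiplication_complex[of b "p + 1"] in auto)
    then have inner: "of_nat b ^ p * (\<Sum>m<M. \<psi> (int m) * f (x n + y m))
        = (\<Sum>j<k2. \<psi> (int j) * f (real j / real k2 + real b * x n))" for n
      using assms(1) by (simp add: add.commute)
    have bx: "real b * x n = real (b' * n) / real (c' * k1)" for n
      using q by (simp add: x_def N_def bc)
    have "of_nat c' ^ (p + 1) * (\<Sum>n<N. \<chi>1 (int n) * f (real b * x n + real j / real k2))
        = of_nat q * of_nat c' * (\<Sum>h<k1. \<chi>1 (int h) *
            f (real (b' * h) / real k1 + real c' * (real j / real k2)))" for j
      unfolding bx N_def bc(2) f_def
      by (rule character_sum_multiplication_gcd) (use c' bc(3) k per1 assms(4) in auto)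
    then have outer: "of_nat c' ^ p * (\<Sum>n<N. \<chi>1 (int n) * f (real j / real k2 + real b * x n))
        = of_nat q * (\<Sum>h<k1. \<chi>1 (int h) *
            f (real (b' * h) / real k1 + real c' * (real j / real k2)))" for j
      using c' by (simp add: add.commute)
    have "of_nat c' ^ p * (of_nat b ^ p * T (\<lambda>n m. bernoulli_fun (p + 1) (x n + y m)))
        = of_nat c' ^ p * (\<Sum>n<N. \<chi>1 (int n) * (of_nat b ^ p * (\<Sum>m<M. \<psi> (int m) * f (x n + y m))))"
      unfolding T_def f_def by (simp only: sum_distrib_left mult_ac)
    also have "\<dots> = (\<Sum>j<k2. \<psi> (int j) *
        (of_nat c' ^ p * (\<Sum>n<N. \<chi>1 (int n) * f (real j / real k2 + real b * x n))))"
      unfolding inner unfolding sum_distrib_left by (subst sum.swap) (simp only: mult_ac)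
    also have "\<dots> = of_nat q * (\<Sum>h<k1. \<Sum>j<k2. \<chi>1 (int h) * \<psi> (int j) *
          f (real (b' * h) / real k1 + real c' * (real j / real k2)))"
      unfolding outer unfolding sum_distrib_left by (subst sum.swap) (simp only: mult_ac)
    also have "(\<Sum>h<k1. \<Sum>j<k2. \<chi>1 (int h) * \<psi> (int j) *
          f (real (b' * h) / real k1 + real c' * (real j / real k2))) = ?H"
    proof -
      \<comment> \<open>The characters vanish at \<open>0\<close> and at their modulus, so both ranges give the same sum.\<close>
      have drop: "(\<Sum>h<l. g h) = (\<Sum>h = 1..l. g h)" if "l > 0" "g 0 = 0" "g l = 0"
        for g :: "nat \<Rightarrow> complex" and l
      proof -
        have "(\<Sum>h<l. g h) = (\<Sum>h\<le>l. g h)" using that by (simp flip: lessThan_Suc_atMost)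
        also have "{..l} = insert 0 {1..l}" by auto
        finally show ?thesis using that by simp
      qed
      have z: "\<chi>1 (int k1) = 0" "\<psi> 0 = 0" "\<psi> (int k2) = 0"
        using per1[of 0] per[of 0] zero by (simp_all add: \<psi>_def conj_char_def)
      have arg: "real (b' * h) / real k1 + real c' * (real j / real k2)
          = real (c * j) / real (q * k2) + real (b * h) / real (q * k1)" for h j
        using q by (simp add: bc)
      show ?thesis unfolding arg f_def
        using z zero k by (simp add: drop)
    qed
    finally have *: "of_nat c' ^ p * (of_nat b ^ p * T (\<lambda>n m. bernoulli_fun (p + 1) (x n + y m)))
        = of_nat q * ?H" .
    have "of_nat (N * M) ^ p * T (\<lambda>n m. bernoulli_fun (p + 1) (x n + y m))
        = of_nat q ^ p * of_nat (k1 * k2) ^ p *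
          (of_nat c' ^ p * (of_nat b ^ p * T (\<lambda>n m. bernoulli_fun (p + 1) (x n + y m))))"
      by (simp add: N_def M_def bc(2) power_mult_distrib mult_ac)
    then show ?thesis unfolding * by (simp add: mult_ac)
  qed
  have "T (\<lambda>n m. \<Sum>j = 0..p + 1. of_nat ((p + 1) choose j) * bernpoly j (x n) * bernpoly (p + 1 - j) (y m))
      = T (\<lambda>n m. real (p + 1) * (bernoulli_fun p (x n + y m) * bernoulli_fun 1 (x n)
            + bernoulli_fun p (x n + y m) * bernoulli_fun 1 (y m))
          - real p * bernoulli_fun (p + 1) (x n + y m))"
  proof (rule T_cong)
    fix n m assume "0 < n" "n < N" "0 < m" "m < M"
    then show "(\<Sum>j = 0..p + 1. of_nat ((p + 1) choose j) * bernpoly j (x n) * bernpoly (p + 1 - j) (y m))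
      = real (p + 1) * (bernoulli_fun p (x n + y m) * bernoulli_fun 1 (x n)
            + bernoulli_fun p (x n + y m) * bernoulli_fun 1 (y m))
          - real p * bernoulli_fun (p + 1) (x n + y m)"
      using bernpoly_convolution_periodic[OF assms(4), of "x n" "y m"]
      by (simp add: x_def y_def distrib_left)
  qed
  then have main: "T (\<lambda>n m. \<Sum>j = 0..p + 1. of_nat ((p + 1) choose j) * bernpoly j (x n) * bernpoly (p + 1 - j) (y m))
      = of_nat (p + 1) * (T (\<lambda>n m. bernoulli_fun p (x n + y m) * bernoulli_fun 1 (x n))
            + T (\<lambda>n m. bernoulli_fun p (x n + y m) * bernoulli_fun 1 (y m)))
          - of_nat p * T (\<lambda>n m. bernoulli_fun (p + 1) (x n + y m))"
    by (simp only: T_add T_diff T_scale of_real_of_nat_eq)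
  have rearrange: "r * (P * t1 + P * t2) = P * (r * (t1 + t2) - s * t3) + s * (P * t3)"
    for r s P t1 t2 t3 :: complex
    by (simp add: algebra_simps)
  show ?thesis
    unfolding M_def [symmetric] N_def [symmetric] \<psi>_def [symmetric] S1 S2 conv main
      mult.assoc[of "of_nat p"] last [symmetric]
    by (rule rearrange)
qed

end
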